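(* For every nonempty compactum $X$ there is a point $p\in X$ such that $\mathrm{Nbhd}(p,X)$ is not cofinally equivalent to $\omega\times\omega_2$.
   Context: A compactum is a compact Hausdorff space. $\mathrm{Nbhd}(p,X)$ is the neighborhood filter of $p$ in $X$, i.e. the set of all $U\subseteq X$ such that $p$ is in the interior of $U$, preordered by containment $\supseteq$ (smaller neighborhoods are greater). Preorders $P$ and $Q$ are cofinally equivalent if there is a preorder $R$ such that $P$ and $Q$ are order isomorphic to cofinal subsets of $R$. $\omega\times\omega_2$ has the coordinatewise order. *)

theory Defs
  imports "HOL-Analysis.Analysis"
begin

text \<open>A preorder is a relation \<open>P\<close> with \<open>Preorder P\<close>; its underlying set is \<open>Field P\<close>,
  and \<open>(x, y) \<in> P\<close> means \<open>x \<le> y\<close>.\<close>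

definition order_isomorphic :: "'a rel \<Rightarrow> 'b rel \<Rightarrow> bool" where
  "order_isomorphic P Q \<longleftrightarrow>
     (\<exists>f. bij_betw f (Field P) (Field Q) \<and>
          (\<forall>x\<in>Field P. \<forall>y\<in>Field P. (x, y) \<in> P \<longleftrightarrow> (f x, f y) \<in> Q))"

text \<open>This is the non-strict notion, unlike the library's \<open>cofinal\<close>, which demands a bound
  different from the given element.\<close>

definition cofinal_subset :: "'a set \<Rightarrow> 'a rel \<Rightarrow> bool" where
  "cofinal_subset C R \<longleftrightarrow> C \<subseteq> Field R \<and> (\<forall>x\<in>Field R. \<exists>y\<in>C. (x, y) \<in> R)"

definition cofinally_equivalent_via :: "'r rel \<Rightarrow> 'p rel \<Rightarrow> 'q rel \<Rightarrow> bool" where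
  "cofinally_equivalent_via R P Q \<longleftrightarrow>
     Preorder R \<and>
     (\<exists>C D. cofinal_subset C R \<and> order_isomorphic P (Restr R C) \<and>
            cofinal_subset D R \<and> order_isomorphic Q (Restr R D))"

text \<open>The ambient preorder may be any preorder at all, but HOL cannot quantify over types inside
  a formula. The type \<open>'p + 'q\<close> is large enough, because an ambient preorder may be cut down to
  the union of the two cofinal subsets; see lemma \<open>cofinally_equivalentI\<close>.\<close>

definition cofinally_equivalent :: "'p rel \<Rightarrow> 'q rel \<Rightarrow> bool" where
  "cofinally_equivalent P Q \<longleftrightarrow> (\<exists>R :: ('p + 'q) rel. cofinally_equivalent_via R P Q)"

lemma Field_Restr_Preorder:
  assumes "Preorder R" "C \<subseteq> Field R"
  shows "Field (Restr R C) = C"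
  using assms by (auto simp: Field_def preorder_on_def refl_on_def)

lemma order_isomorphic_trans:
  assumes "order_isomorphic P Q" "order_isomorphic Q S"
  shows "order_isomorphic P S"
proof -
  obtain f where f: "bij_betw f (Field P) (Field Q)"
    "\<forall>x\<in>Field P. \<forall>y\<in>Field P. (x, y) \<in> P \<longleftrightarrow> (f x, f y) \<in> Q"
    using assms(1) unfolding order_isomorphic_def by blast
  obtain g where g: "bij_betw g (Field Q) (Field S)"
    "\<forall>x\<in>Field Q. \<forall>y\<in>Field Q. (x, y) \<in> Q \<longleftrightarrow> (g x, g y) \<in> S"
    using assms(2) unfolding order_isomorphic_def by blast
  have "f x \<in> Field Q" if "x \<in> Field P" for x
    using f(1) that by (auto simp: bij_betw_def)
  then have "\<forall>x\<in>Field P. \<forall>y\<in>Field P. (x, y) \<in> P \<longleftrightarrow> ((g \<circ> f) x, (g \<circ> f) y) \<in> S"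
    using f(2) g(2) by simp
  then show ?thesis
    unfolding order_isomorphic_def using bij_betw_trans[OF f(1) g(1)] by blast
qed

lemma cofinally_equivalentI:
  fixes R :: "'r rel" and P :: "'p rel" and Q :: "'q rel"
  assumes "cofinally_equivalent_via R P Q"
  shows "cofinally_equivalent P Q"
proof -
  obtain C D where R: "Preorder R"
    and C: "cofinal_subset C R" "order_isomorphic P (Restr R C)"
    and D: "cofinal_subset D R" "order_isomorphic Q (Restr R D)"
    using assms unfolding cofinally_equivalent_via_def by blast
  have CF: "C \<subseteq> Field R" and DF: "D \<subseteq> Field R"
    using C(1) D(1) by (auto simp: cofinal_subset_def)
  note FC = Field_Restr_Preorder[OF R CF] and FD = Field_Restr_Preorder[OF R DF]
  obtain f where f: "bij_betw f (Field P) C"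
    using C(2) unfolding order_isomorphic_def FC by blast
  obtain g where g: "bij_betw g (Field Q) D"
    using D(2) unfolding order_isomorphic_def FD by blast
  define h :: "'r \<Rightarrow> 'p + 'q" where
    "h z = (if z \<in> C then Inl (inv_into (Field P) f z) else Inr (inv_into (Field Q) g z))" for z
  have hinj: "inj_on h (C \<union> D)"
  proof (rule inj_onI)
    fix x y assume xy: "x \<in> C \<union> D" "y \<in> C \<union> D" and eq: "h x = h y"
    show "x = y"
    proof (cases "x \<in> C")
      case True
      then have "y \<in> C" "inv_into (Field P) f x = inv_into (Field P) f y"
        using eq by (simp_all add: h_def split: if_splits)
      then show ?thesis
        using True by (metis f bij_betw_inv_into_right)
    next
      case False
      then have "y \<notin> C" "inv_into (Field Q) g x = inv_into (Field Q) g y"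
        using eq by (simp_all add: h_def split: if_splits)
      then show ?thesis
        using False xy by (metis UnE g bij_betw_inv_into_right)
    qed
  qed
  define S where "S = {(h x, h y) |x y. x \<in> C \<union> D \<and> y \<in> C \<union> D \<and> (x, y) \<in> R}"
  have S_iff: "(h x, h y) \<in> S \<longleftrightarrow> (x, y) \<in> R" if "x \<in> C \<union> D" "y \<in> C \<union> D" for x y
  proof
    assume "(h x, h y) \<in> S"
    then obtain u v where "h x = h u" "h y = h v" "u \<in> C \<union> D" "v \<in> C \<union> D" "(u, v) \<in> R"
      unfolding S_def by blast
    then show "(x, y) \<in> R" using that inj_onD[OF hinj] by metis
  next
    assume "(x, y) \<in> R"
    then show "(h x, h y) \<in> S" using that unfolding S_def by blast
  qed
  have rR: "(x, x) \<in> R" if "x \<in> C \<union> D" for x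
    using R CF DF that by (auto simp: preorder_on_def refl_on_def)
  have S_sub: "S \<subseteq> h ` (C \<union> D) \<times> h ` (C \<union> D)"
    unfolding S_def by auto
  have FS: "Field S = h ` (C \<union> D)"
  proof
    show "Field S \<subseteq> h ` (C \<union> D)"
      using S_sub by (auto simp: Field_def)
    show "h ` (C \<union> D) \<subseteq> Field S"
    proof
      fix a assume "a \<in> h ` (C \<union> D)"
      then obtain x where "x \<in> C \<union> D" "a = h x" by (rule imageE)
      then have "(a, a) \<in> S" using S_iff[of x x] rR[of x] by simp
      then show "a \<in> Field S" by (rule FieldI1)
    qed
  qed
  have tS: "trans S"
  proof (rule transI)
    fix a b c assume ab: "(a, b) \<in> S" and bc: "(b, c) \<in> S"
    have "a \<in> h ` (C \<union> D)" "b \<in> h ` (C \<union> D)" "c \<in> h ` (C \<union> D)"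
      using ab bc S_sub by auto
    then obtain x y z where xyz: "x \<in> C \<union> D" "y \<in> C \<union> D" "z \<in> C \<union> D"
      and eqs: "a = h x" "b = h y" "c = h z"
      by (elim imageE)
    have "(x, y) \<in> R" "(y, z) \<in> R"
      using ab bc S_iff[OF xyz(1,2)] S_iff[OF xyz(2,3)] unfolding eqs by simp_all
    moreover have "trans R"
      using R unfolding preorder_on_def by blast
    ultimately have "(x, z) \<in> R"
      by (blast dest: transD)
    then show "(a, c) \<in> S" using S_iff[OF xyz(1,3)] unfolding eqs by simp
  qed
  have PS: "Preorder S"
    unfolding preorder_on_def refl_on_def FS
  proof (intro conjI ballI)
    show "S \<subseteq> h ` (C \<union> D) \<times> h ` (C \<union> D)" by (rule S_sub)
    show "trans S" by (rule tS)
    fix a assume "a \<in> h ` (C \<union> D)"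
    then obtain x where "x \<in> C \<union> D" "a = h x" by (rule imageE)
    then show "(a, a) \<in> S" using S_iff[of x x] rR[of x] by simp
  qed
  have cof: "cofinal_subset (h ` E) S" and iso: "order_isomorphic (Restr R E) (Restr S (h ` E))"
    if E: "cofinal_subset E R" "E \<subseteq> C \<union> D" for E
  proof -
    have EF: "E \<subseteq> Field R" using E(1) by (simp add: cofinal_subset_def)
    show "cofinal_subset (h ` E) S"
      unfolding cofinal_subset_def FS
    proof (intro conjI ballI)
      show "h ` E \<subseteq> h ` (C \<union> D)" using E(2) by blast
      fix a assume "a \<in> h ` (C \<union> D)"
      then obtain x where x: "x \<in> C \<union> D" "a = h x" by blast
      then have "x \<in> Field R" using CF DF by blast
      then obtain y where "y \<in> E" "(x, y) \<in> R"
        using E(1) unfolding cofinal_subset_def by blast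
      then have "h y \<in> h ` E" "(a, h y) \<in> S" using x E(2) S_iff[of x y] by auto
      then show "\<exists>b\<in>h ` E. (a, b) \<in> S" by (rule bexI[rotated])
    qed
    have FE: "Field (Restr R E) = E" "Field (Restr S (h ` E)) = h ` E"
      using Field_Restr_Preorder[OF R EF] Field_Restr_Preorder[OF PS, of "h ` E"] E(2) FS by auto
    have "bij_betw h E (h ` E)"
      using hinj E(2) by (meson bij_betw_imageI inj_on_subset)
    moreover have "\<forall>x\<in>E. \<forall>y\<in>E. (x, y) \<in> Restr R E \<longleftrightarrow> (h x, h y) \<in> Restr S (h ` E)"
    proof (intro ballI)
      fix x y assume "x \<in> E" "y \<in> E"
      then show "(x, y) \<in> Restr R E \<longleftrightarrow> (h x, h y) \<in> Restr S (h ` E)"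
        using S_iff[of x y] E(2) by auto
    qed
    ultimately show "order_isomorphic (Restr R E) (Restr S (h ` E))"
      unfolding order_isomorphic_def FE by blast
  qed
  have "cofinally_equivalent_via S P Q"
    unfolding cofinally_equivalent_via_def
    using PS cof[OF C(1) Un_upper1] cof[OF D(1) Un_upper2]
      order_isomorphic_trans[OF C(2) iso[OF C(1) Un_upper1]]
      order_isomorphic_trans[OF D(2) iso[OF D(1) Un_upper2]] by blast
  then show ?thesis unfolding cofinally_equivalent_def by blast
qed

definition compactum :: "'a topology \<Rightarrow> bool" where
  "compactum X \<longleftrightarrow> compact_space X \<and> Hausdorff_space X"

definition Nbhd_set :: "'a \<Rightarrow> 'a topology \<Rightarrow> 'a set set" where
  "Nbhd_set p X = {U. U \<subseteq> topspace X \<and> p \<in> X interior_of U}"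

definition Nbhd :: "'a \<Rightarrow> 'a topology \<Rightarrow> 'a set rel" where
  "Nbhd p X = {(U, V). U \<in> Nbhd_set p X \<and> V \<in> Nbhd_set p X \<and> U \<supseteq> V}"

definition coordinatewise :: "'a rel \<Rightarrow> 'b rel \<Rightarrow> ('a \<times> 'b) rel" where
  "coordinatewise P Q = {((a, b), (a', b')). (a, a') \<in> P \<and> (b, b') \<in> Q}"

text \<open>\<open>natLeq\<close> is the ordinal \<open>\<omega>\<close>. A cardinal in the library is a well-order of minimal order type
  for the cardinality of its field, and \<open>cardSuc\<close> yields the successor cardinal, so iterating it
  twice from \<open>natLeq\<close> gives, up to isomorphism, the initial ordinal \<open>\<omega>\<^sub>2\<close> with its usual
  order.\<close>

definition omega2 :: "nat set set rel" where
  "omega2 = cardSuc (cardSuc natLeq)"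

end

theory Submission
  imports Defs "HOL-Library.Countable_Set_Type"
begin

text \<open>Suppose that every point of a nonempty compactum \<open>X\<close> has a neighborhood filter of the
  cofinal type of \<open>\<omega> \<times> \<omega>\<^sub>2\<close>. Reading off the \<open>\<omega>\<close>-coordinate grades each neighborhood filter into
  countably many levels, and because every subset of \<open>\<omega>\<^sub>2\<close> of size at most \<open>\<omega>\<^sub>1\<close> is bounded, any
  \<open>\<omega>\<^sub>1\<close> neighborhoods of \<open>p\<close> from one level have a common refinement that is again a neighborhood
  of \<open>p\<close> (\<open>natLeq_times_cardSuc_level_directed\<close>). This is used twice.

  First, at every point, it makes \<open>X\<close> countably tight. Failure of countable tightness in a
  compactum produces a free sequence \<open>(a\<^sub>i)\<close> of length \<open>\<omega>\<^sub>1\<close>, in which the closures of an initial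
  segment and of the remaining tail are always disjoint. By compactness, some point \<open>z\<close> lies in the
  closure of every tail, hence in the closure of no proper initial segment. The complements of the closures
  of the initial segments are \<open>\<omega>\<^sub>1\<close> decreasing neighborhoods of \<open>z\<close>; uncountably many of them lie on
  one level, so some neighborhood of \<open>z\<close> refines uncountably many, hence all, of them, and misses
  the whole sequence (\<open>no_cluster_point_of_free_sequence\<close>).

  Second, at a single point \<open>p\<close>, it turns countable tightness into a countable neighborhood base.
  Let \<open>K\<^sub>n\<close> be the intersection of all neighborhoods on level \<open>n\<close>. If \<open>K\<^sub>n\<close> were not a
  neighborhood of \<open>p\<close>, then \<open>p\<close> would be in the closure of a countable set \<open>S\<close> disjoint from
  \<open>K\<^sub>n\<close>; each point of \<open>S\<close> is excluded by some neighborhood on level \<open>n\<close>, and a common refinement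
  of these countably many neighborhoods separates \<open>p\<close> from \<open>S\<close>. So the sets \<open>K\<^sub>n\<close> are neighborhoods,
  and by construction every neighborhood contains one of them
  (\<open>countable_base_if_level_directed_countably_tight\<close>). But \<open>\<omega> \<times> \<omega>\<^sub>2\<close>, hence also the neighborhood
  filter of \<open>p\<close>, has uncountable cofinality
  (\<open>natLeq_times_cardSuc_no_countable_cofinal\<close>).\<close>

unbundle cardinal_syntax

section \<open>The cofinal type of a product with a successor cardinal\<close>

text \<open>Cofinal equivalence enters the argument only through this pair of maps: go up in the ambient
  preorder from one cofinal copy to the other. No monotonicity can be expected of them, but bounds of
  images pull back: the third property makes \<open>f\<close> send unbounded sets to unbounded sets, and the fourth
  does the same for \<open>g\<close>.\<close>

lemma cofinally_equivalent_Tukey: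
  fixes P :: "'p rel" and Q :: "'q rel"
  assumes "cofinally_equivalent P Q"
  obtains f g where
    "f ` Field P \<subseteq> Field Q" "g ` Field Q \<subseteq> Field P"
    "\<And>x y. \<lbrakk>x \<in> Field P; y \<in> Field Q; (f x, y) \<in> Q\<rbrakk> \<Longrightarrow> (x, g y) \<in> P"
    "\<And>x y. \<lbrakk>x \<in> Field P; y \<in> Field Q; (g y, x) \<in> P\<rbrakk> \<Longrightarrow> (y, f x) \<in> Q"
proof -
  obtain R :: "('p + 'q) rel" and C D where R: "Preorder R"
    and C: "cofinal_subset C R" "order_isomorphic P (Restr R C)"
    and D: "cofinal_subset D R" "order_isomorphic Q (Restr R D)"
    using assms unfolding cofinally_equivalent_def cofinally_equivalent_via_def by blast
  have CF: "C \<subseteq> Field R" and DF: "D \<subseteq> Field R"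
    using C(1) D(1) by (auto simp: cofinal_subset_def)
  have tr: "(a, c) \<in> R" if "(a, b) \<in> R" "(b, c) \<in> R" for a b c
    using R that unfolding preorder_on_def by (blast dest: transD)
  obtain \<phi> where \<phi>: "bij_betw \<phi> (Field P) C"
      "\<forall>x\<in>Field P. \<forall>y\<in>Field P. (x, y) \<in> P \<longleftrightarrow> (\<phi> x, \<phi> y) \<in> Restr R C"
    using C(2) unfolding order_isomorphic_def Field_Restr_Preorder[OF R CF] by blast
  obtain \<psi> where \<psi>: "bij_betw \<psi> (Field Q) D"
      "\<forall>x\<in>Field Q. \<forall>y\<in>Field Q. (x, y) \<in> Q \<longleftrightarrow> (\<psi> x, \<psi> y) \<in> Restr R D"
    using D(2) unfolding order_isomorphic_def Field_Restr_Preorder[OF R DF] by blast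
  have \<phi>C: "\<phi> x \<in> C" if "x \<in> Field P" for x
    using \<phi>(1) that by (auto simp: bij_betw_def)
  have \<psi>D: "\<psi> y \<in> D" if "y \<in> Field Q" for y
    using \<psi>(1) that by (auto simp: bij_betw_def)
  have "\<exists>y\<in>Field Q. (\<phi> x, \<psi> y) \<in> R" if x: "x \<in> Field P" for x
  proof -
    obtain d where "d \<in> D" "(\<phi> x, d) \<in> R"
      using D(1) \<phi>C[OF x] CF unfolding cofinal_subset_def by blast
    then show ?thesis
      using \<psi>(1) unfolding bij_betw_def by blast
  qed
  then obtain f where f: "\<And>x. x \<in> Field P \<Longrightarrow> f x \<in> Field Q \<and> (\<phi> x, \<psi> (f x)) \<in> R"
    by metis
  have "\<exists>x\<in>Field P. (\<psi> y, \<phi> x) \<in> R" if y: "y \<in> Field Q" for y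
  proof -
    obtain c where "c \<in> C" "(\<psi> y, c) \<in> R"
      using C(1) \<psi>D[OF y] DF unfolding cofinal_subset_def by blast
    then show ?thesis
      using \<phi>(1) unfolding bij_betw_def by blast
  qed
  then obtain g where g: "\<And>y. y \<in> Field Q \<Longrightarrow> g y \<in> Field P \<and> (\<psi> y, \<phi> (g y)) \<in> R"
    by metis
  show thesis
  proof (rule that)
    show "f ` Field P \<subseteq> Field Q" "g ` Field Q \<subseteq> Field P"
      using f g by auto
  next
    fix x y assume x: "x \<in> Field P" and y: "y \<in> Field Q" and "(f x, y) \<in> Q"
    then have "(\<psi> (f x), \<psi> y) \<in> R"
      using \<psi>(2) f[OF x] by blast
    then have "(\<phi> x, \<phi> (g y)) \<in> R"
      using f[OF x] g[OF y] tr by blast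
    then show "(x, g y) \<in> P"
      using \<phi>(2) x g[OF y] \<phi>C by blast
  next
    fix x y assume x: "x \<in> Field P" and y: "y \<in> Field Q" and "(g y, x) \<in> P"
    then have "(\<phi> (g y), \<phi> x) \<in> R"
      using \<phi>(2) g[OF y] by blast
    then have "(\<psi> y, \<psi> (f x)) \<in> R"
      using f[OF x] g[OF y] tr by blast
    then show "(y, f x) \<in> Q"
      using \<psi>(2) y f[OF x] \<psi>D by blast
  qed
qed

text \<open>Successor cardinals are regular. Their cofinal sets are required by \<open>cofinal\<close> to contain
  strict upper bounds, so for a set that is too small to be cofinal linearity provides a non-strict
  upper bound.\<close>

lemma bounded_in_cardSuc:
  fixes k :: "'k rel" and B :: "'k set set"
  assumes k: "Card_order k" "infinite (Field k)"
    and B: "B \<subseteq> Field (cardSuc k)" "|B| \<le>o k"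
  obtains b where "b \<in> Field (cardSuc k)" "\<And>x. x \<in> B \<Longrightarrow> (x, b) \<in> cardSuc k"
proof -
  let ?s = "cardSuc k"
  have "|B| <o ?s"
    using B(2) cardSuc_greater[OF k(1)] ordLeq_ordLess_trans by blast
  then have "\<not> cofinal B ?s"
    using infinite_cardSuc_regularCard[OF k(2,1)] B(1) not_ordLess_ordIso
    unfolding regularCard_def by blast
  then obtain b where b: "b \<in> Field ?s" "\<And>x. x \<in> B \<Longrightarrow> b = x \<or> (b, x) \<notin> ?s"
    unfolding cofinal_def by blast
  have "Linear_order ?s"
    using cardSuc_Card_order[OF k(1)] unfolding card_order_on_def well_order_on_def by blast
  then have refl: "refl_on (Field ?s) ?s" and tot: "total_on (Field ?s) ?s"
    unfolding linear_order_on_def partial_order_on_def preorder_on_def by auto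
  have "(x, b) \<in> ?s" if "x \<in> B" for x
  proof (cases "b = x")
    case True
    then show ?thesis using refl b(1) by (auto dest: refl_onD)
  next
    case False
    then show ?thesis using tot b that B(1) unfolding total_on_def by blast
  qed
  with b(1) show thesis using that by blast
qed

lemma Field_coordinatewise:
  assumes "refl_on (Field P) P" "refl_on (Field Q) Q"
  shows "Field (coordinatewise P Q) = Field P \<times> Field Q"
proof
  show "Field (coordinatewise P Q) \<subseteq> Field P \<times> Field Q"
    by (auto simp: coordinatewise_def Field_def)
  show "Field P \<times> Field Q \<subseteq> Field (coordinatewise P Q)"
  proof
    fix z assume "z \<in> Field P \<times> Field Q"
    then have "(z, z) \<in> coordinatewise P Q"
      using assms by (auto simp: coordinatewise_def dest: refl_onD)
    then show "z \<in> Field (coordinatewise P Q)" by (rule FieldI1)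
  qed
qed

lemma Field_natLeq_times_cardSuc:
  assumes "Card_order k"
  shows "Field (coordinatewise natLeq (cardSuc k)) = UNIV \<times> Field (cardSuc k)"
proof -
  have "refl_on (Field (cardSuc k)) (cardSuc k)"
    using cardSuc_Card_order[OF assms]
    unfolding card_order_on_def well_order_on_def linear_order_on_def partial_order_on_def
      preorder_on_def by blast
  then show ?thesis
    using Field_coordinatewise[OF natLeq_Refl] by (simp add: Field_natLeq)
qed

text \<open>A graded form of directedness that survives in products \<open>\<omega> \<times> k\<^sup>+\<close>: these are not even
  countably directed, but each level of the grading \<open>\<rho>\<close> has bounds, in the whole of \<open>P\<close>, for all its
  subsets of size at most \<open>k\<close>.\<close>

definition level_directed :: "'k rel \<Rightarrow> 'p rel \<Rightarrow> ('p \<Rightarrow> nat) \<Rightarrow> bool" where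
  "level_directed k P \<rho> \<longleftrightarrow>
     (\<forall>n U. U \<subseteq> {x \<in> Field P. \<rho> x = n} \<longrightarrow> |U| \<le>o k \<longrightarrow> (\<exists>b\<in>Field P. \<forall>u\<in>U. (u, b) \<in> P))"

text \<open>The grading is the first coordinate of the Tukey map \<open>f\<close>. On a level the image of \<open>f\<close> varies
  only in the second coordinate, where regularity of the successor cardinal yields a bound, which
  \<open>g\<close> carries back to \<open>P\<close>.\<close>

lemma natLeq_times_cardSuc_level_directed:
  fixes P :: "'p rel" and k :: "'k rel"
  assumes k: "Card_order k" "infinite (Field k)"
    and eq: "cofinally_equivalent P (coordinatewise natLeq (cardSuc k))"
  obtains \<rho> where "level_directed k P \<rho>"
proof -
  let ?Q = "coordinatewise natLeq (cardSuc k)"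
  note FQ = Field_natLeq_times_cardSuc[OF k(1)]
  obtain f g where f: "f ` Field P \<subseteq> Field ?Q" and g: "g ` Field ?Q \<subseteq> Field P"
    and fg: "\<And>x y. \<lbrakk>x \<in> Field P; y \<in> Field ?Q; (f x, y) \<in> ?Q\<rbrakk> \<Longrightarrow> (x, g y) \<in> P"
    by (rule cofinally_equivalent_Tukey[OF eq]) blast
  have "level_directed k P (fst \<circ> f)"
    unfolding level_directed_def
  proof (intro allI impI)
    fix n U assume U: "U \<subseteq> {x \<in> Field P. (fst \<circ> f) x = n}" and card: "|U| \<le>o k"
    have "f u \<in> Field ?Q" if "u \<in> U" for u
      using U f that by blast
    then have "(snd \<circ> f) ` U \<subseteq> Field (cardSuc k)"
      unfolding FQ by (auto simp: mem_Times_iff)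
    moreover have "|(snd \<circ> f) ` U| \<le>o k"
      using card_of_image card ordLeq_transitive by blast
    ultimately obtain b where b: "b \<in> Field (cardSuc k)"
        "\<And>x. x \<in> (snd \<circ> f) ` U \<Longrightarrow> (x, b) \<in> cardSuc k"
      using bounded_in_cardSuc[OF k] by blast
    have nb: "(n, b) \<in> Field ?Q"
      using b(1) FQ by simp
    have "(u, g (n, b)) \<in> P" if u: "u \<in> U" for u
    proof (rule fg)
      show "u \<in> Field P" "(n, b) \<in> Field ?Q" using u U nb by auto
      obtain c where c: "f u = (n, c)" using u U by (cases "f u") auto
      then have "(c, b) \<in> cardSuc k" using b(2) u by force
      then show "(f u, (n, b)) \<in> ?Q" by (simp add: c coordinatewise_def natLeq_def)
    qed
    moreover have "g (n, b) \<in> Field P" using g nb by blast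
    ultimately show "\<exists>b\<in>Field P. \<forall>u\<in>U. (u, b) \<in> P" by blast
  qed
  then show thesis by (rule that)
qed

text \<open>The second coordinates of the images of countably many elements have an upper bound \<open>b\<close>, which
  is not a maximum; the image under \<open>g\<close> of a pair with second coordinate strictly above \<open>b\<close> is
  therefore not below any of them.\<close>

lemma natLeq_times_cardSuc_no_countable_cofinal:
  fixes P :: "'p rel" and k :: "'k rel"
  assumes k: "Card_order k" "infinite (Field k)"
    and eq: "cofinally_equivalent P (coordinatewise natLeq (cardSuc k))"
    and "countable C"
  shows "\<not> cofinal_subset C P"
proof
  assume C: "cofinal_subset C P"
  let ?s = "cardSuc k" and ?Q = "coordinatewise natLeq (cardSuc k)"
  note FQ = Field_natLeq_times_cardSuc[OF k(1)]
  obtain f g where f: "f ` Field P \<subseteq> Field ?Q" and g: "g ` Field ?Q \<subseteq> Field P"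
    and gf: "\<And>x y. \<lbrakk>x \<in> Field P; y \<in> Field ?Q; (g y, x) \<in> P\<rbrakk> \<Longrightarrow> (y, f x) \<in> ?Q"
    by (rule cofinally_equivalent_Tukey[OF eq]) blast
  have CF: "C \<subseteq> Field P" using C by (simp add: cofinal_subset_def)
  have "countable ((snd \<circ> f) ` C)" using \<open>countable C\<close> by simp
  then have "|(snd \<circ> f) ` C| \<le>o natLeq" by (simp add: countable_card_le_natLeq)
  moreover have "natLeq \<le>o k"
    using k natLeq_ordLeq_cinfinite[of k] by (simp add: cinfinite_def)
  ultimately have "|(snd \<circ> f) ` C| \<le>o k" using ordLeq_transitive by blast
  moreover have "(snd \<circ> f) ` C \<subseteq> Field ?s"
  proof -
    have "f c \<in> Field ?Q" if "c \<in> C" for c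
      using CF f that by blast
    then show ?thesis
      unfolding FQ by (auto simp: mem_Times_iff)
  qed
  ultimately obtain b where b: "b \<in> Field ?s" "\<And>x. x \<in> (snd \<circ> f) ` C \<Longrightarrow> (x, b) \<in> ?s"
    using bounded_in_cardSuc[OF k] by blast
  have Cs: "Card_order ?s" and infs: "infinite (Field ?s)"
    using k cardSuc_Card_order cardSuc_finite by auto
  obtain b' where b': "b' \<in> Field ?s" "b \<noteq> b'" "(b, b') \<in> ?s"
    using infinite_Card_order_limit[OF Cs infs b(1)] by blast
  have Q: "(0, b') \<in> Field ?Q" using b'(1) FQ by simp
  then obtain c where c: "c \<in> C" "(g (0, b'), c) \<in> P"
    using C g unfolding cofinal_subset_def by blast
  then have "((0, b'), f c) \<in> ?Q" using gf Q CF by blast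
  then have "(b', snd (f c)) \<in> ?s" by (auto simp: coordinatewise_def split_beta)
  moreover have "(snd (f c), b) \<in> ?s" using b(2) c(1) by simp
  moreover have "trans ?s" "antisym ?s"
    using Cs unfolding card_order_on_def well_order_on_def linear_order_on_def
      partial_order_on_def preorder_on_def by auto
  ultimately show False using b'(2,3) by (metis antisymD transD)
qed

section \<open>Compactness\<close>

lemma compact_space_chain_Inter:
  assumes "compact_space X" and "\<C> \<noteq> {}"
    and clo: "\<And>C. C \<in> \<C> \<Longrightarrow> closedin X C \<and> C \<noteq> {}"
    and chain: "\<And>C D. \<lbrakk>C \<in> \<C>; D \<in> \<C>\<rbrakk> \<Longrightarrow> C \<subseteq> D \<or> D \<subseteq> C"
  shows "\<Inter>\<C> \<noteq> {}"
proof -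
  have "\<exists>C\<in>\<C>. C \<subseteq> \<Inter>\<F>" if "finite \<F>" "\<F> \<subseteq> \<C>" for \<F>
    using that
  proof (induction \<F>)
    case empty
    then show ?case using \<open>\<C> \<noteq> {}\<close> by auto
  next
    case (insert D \<F>)
    then obtain C where "C \<in> \<C>" "C \<subseteq> \<Inter>\<F>" by auto
    then show ?case using chain[of C D] insert.prems by auto
  qed
  then have "\<forall>\<F>. finite \<F> \<and> \<F> \<subseteq> \<C> \<longrightarrow> \<Inter>\<F> \<noteq> {}" using clo by fastforce
  then show ?thesis using assms(1) clo unfolding compact_space_fip by blast
qed

lemma closure_of_meets_interior_of:
  assumes "x \<in> X closure_of S" "x \<in> X interior_of W"
  obtains y where "y \<in> S" "y \<in> W"
proof -
  have "\<exists>y. y \<in> S \<and> y \<in> X interior_of W"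
    using assms openin_interior_of[of X W] by (simp add: in_closure_of)
  then show thesis using that interior_of_subset[of X W] by blast
qed

text \<open>\<open>A\<close> itself may miss a countable intersection of neighborhoods of \<open>p\<close>, but the points reached
  from \<open>A\<close> by countable closures do not: choose \<open>b\<^sub>n\<close> in \<open>A\<close> and in the first \<open>n + 1\<close> of the
  neighborhoods and take a cluster point of the sequence \<open>(b\<^sub>n)\<close>.\<close>

lemma countable_closed_nbhds_meet_closure:
  assumes X: "compact_space X" and A: "A \<subseteq> topspace X" and p: "p \<in> X closure_of A"
    and \<G>: "countable \<G>" "\<And>G. G \<in> \<G> \<Longrightarrow> closedin X G \<and> p \<in> X interior_of G"
  obtains S where "S \<subseteq> A" "countable S" "X closure_of S \<inter> \<Inter>\<G> \<noteq> {}"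
proof (cases "\<G> = {}")
  case True
  have "A \<noteq> {}" using p by auto
  then obtain a where a: "a \<in> A" by blast
  then have "X closure_of {a} \<noteq> {}"
    using A closure_of_subset[of "{a}" X] by auto
  then show thesis using that[of "{a}"] a True by auto
next
  case False
  define G where "G = from_nat_into \<G>"
  have rG: "range G = \<G>" using False \<G>(1) by (simp add: G_def)
  then have G: "closedin X (G n)" "p \<in> X interior_of G n" for n using \<G>(2) by auto
  have "\<exists>b\<in>A. \<forall>j\<le>n. b \<in> G j" for n
  proof -
    have "openin X (\<Inter>j\<in>{..n}. X interior_of G j)" by (intro openin_INT2) auto
    moreover have "p \<in> (\<Inter>j\<in>{..n}. X interior_of G j)" using G by auto
    ultimately obtain b where "b \<in> A" "b \<in> (\<Inter>j\<in>{..n}. X interior_of G j)"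
      using p unfolding in_closure_of by blast
    then show ?thesis using interior_of_subset[of X] by blast
  qed
  then obtain b where b: "\<And>n. b n \<in> A" "\<And>n j. j \<le> n \<Longrightarrow> b n \<in> G j" by metis
  define K where "K n = X closure_of (b ` {n..})" for n
  have bX: "b ` T \<subseteq> topspace X" for T using b(1) A by blast
  have "\<Inter>(range K) \<noteq> {}"
  proof (rule compact_space_chain_Inter[OF X])
    fix C assume "C \<in> range K"
    then obtain n where n: "C = K n" by blast
    have "b n \<in> K n" unfolding K_def using closure_of_subset[OF bX, of "{n..}"] by auto
    then show "closedin X C \<and> C \<noteq> {}" using n K_def by auto
  next
    fix C D assume "C \<in> range K" "D \<in> range K"
    then obtain m n where mn: "C = K m" "D = K n" by blast
    have "K j \<subseteq> K i" if "i \<le> j" for i j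
      unfolding K_def using that by (intro closure_of_mono) auto
    then show "C \<subseteq> D \<or> D \<subseteq> C" using mn nat_le_linear[of m n] by blast
  qed simp
  then obtain z where z: "\<And>n. z \<in> K n" by auto
  have "z \<in> G n" for n
  proof -
    have "b ` {n..} \<subseteq> G n" using b(2) by auto
    then show ?thesis using z[of n] closure_of_minimal[OF _ G(1)] unfolding K_def by blast
  qed
  then have "z \<in> \<Inter>\<G>" using rG by auto
  moreover have "z \<in> X closure_of range b" using z[of 0] by (simp add: K_def)
  ultimately show thesis using that[of "range b"] b(1) by auto
qed

section \<open>The first uncountable ordinal\<close>

abbreviation omega1 :: "nat set rel" where
  "omega1 \<equiv> cardSuc natLeq"

lemma Card_order_omega1: "Card_order omega1"
  by (rule cardSuc_Card_order[OF natLeq_Card_order])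

lemma infinite_Field_omega1: "infinite (Field omega1)"
  using cardSuc_finite[OF natLeq_Card_order] by (simp add: Field_natLeq)

lemma countable_underS_omega1: "countable (underS omega1 i)"
proof (cases "i \<in> Field omega1")
  case True
  then have "|underS omega1 i| <o omega1"
    by (rule card_of_underS[OF Card_order_omega1])
  then have "|underS omega1 i| \<le>o natLeq"
    by (rule iffD1[OF cardSuc_ordLeq_ordLess[OF natLeq_Card_order card_of_Card_order]])
  then show ?thesis
    by (rule iffD2[OF countable_card_le_natLeq])
next
  case False
  then have "underS omega1 i = {}" by (auto simp: underS_def Field_def)
  then show ?thesis by simp
qed

lemma countable_imp_ordLeq_omega1:
  assumes "countable A"
  shows "|A| \<le>o omega1"
  by (rule ordLeq_transitive[OF iffD1[OF countable_card_le_natLeq assms]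
        cardSuc_ordLeq[OF natLeq_Card_order]])

lemma
  shows omega1_refl: "i \<in> Field omega1 \<Longrightarrow> (i, i) \<in> omega1"
    and omega1_trans: "\<lbrakk>(i, j) \<in> omega1; (j, l) \<in> omega1\<rbrakk> \<Longrightarrow> (i, l) \<in> omega1"
    and omega1_total: "\<lbrakk>i \<in> Field omega1; j \<in> Field omega1\<rbrakk> \<Longrightarrow> (i, j) \<in> omega1 \<or> j \<in> underS omega1 i"
    and omega1_wf: "wf (omega1 - Id)"
proof -
  have "Well_order omega1"
    using Card_order_omega1 by (rule Card_order_wo_rel[unfolded wo_rel_def])
  then have w: "refl_on (Field omega1) omega1" "trans omega1" "total_on (Field omega1) omega1"
      "wf (omega1 - Id)"
    by (simp_all only: well_order_on_def linear_order_on_def partial_order_on_def preorder_on_def)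
  show "i \<in> Field omega1 \<Longrightarrow> (i, i) \<in> omega1" by (rule refl_onD[OF w(1)])
  then show "\<lbrakk>i \<in> Field omega1; j \<in> Field omega1\<rbrakk> \<Longrightarrow> (i, j) \<in> omega1 \<or> j \<in> underS omega1 i"
    using w(3) unfolding total_on_def underS_def by auto
  show "\<lbrakk>(i, j) \<in> omega1; (j, l) \<in> omega1\<rbrakk> \<Longrightarrow> (i, l) \<in> omega1" by (rule transD[OF w(2)])
  show "wf (omega1 - Id)" by (rule w(4))
qed

text \<open>The initial segments of \<open>\<omega>\<^sub>1\<close> are countable, so none of them contains \<open>J\<close>.\<close>

lemma uncountable_omega1_cofinal:
  assumes "J \<subseteq> Field omega1" "uncountable J" "i \<in> Field omega1"
  obtains j where "j \<in> J" "i \<in> underS omega1 j"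
proof -
  have "countable (insert i (underS omega1 i))" using countable_underS_omega1 by simp
  then obtain j where j: "j \<in> J" "j \<noteq> i" "j \<notin> underS omega1 i"
    using assms(2) countable_subset[of J "insert i (underS omega1 i)"] by blast
  then have "(i, j) \<in> omega1" using omega1_total[of i j] assms(1,3) by blast
  then have "i \<in> underS omega1 j" using j(2) by (simp add: underS_def)
  then show thesis by (rule that[OF j(1)])
qed

lemma uncountable_Field_omega1: "uncountable (Field omega1)"
proof
  assume "countable (Field omega1)"
  then have "|Field omega1| \<le>o natLeq" by (rule iffD1[OF countable_card_le_natLeq])
  then have "omega1 \<le>o natLeq"
    by (rule ordIso_ordLeq_trans[OF ordIso_symmetric[OF card_of_Field_ordIso[OF Card_order_omega1]]])
  then show False
    by (rule notE[OF not_ordLess_ordLeq[OF cardSuc_greater[OF natLeq_Card_order]]])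
qed

section \<open>Free sequences and countable tightness\<close>

text \<open>A free sequence of length \<open>\<omega>\<^sub>1\<close> is built by transfinite recursion in the union of the closures
  of the countable subsets of \<open>A\<close>. The points chosen before stage \<open>i\<close> are countably many, so they lie
  in the closure of one countable \<open>T \<subseteq> A\<close>, which misses \<open>p\<close>; regularity gives a closed neighborhood
  \<open>G i\<close> of \<open>p\<close> disjoint from that closure, and the next point is taken from the intersection of
  all the neighborhoods chosen so far. The set \<open>G i\<close> then separates the part of the sequence before
  \<open>i\<close> from the part starting at \<open>i\<close>.\<close>

lemma not_countably_tight_imp_free_sequence:
  assumes X: "compactum X" and A: "A \<subseteq> topspace X" and p: "p \<in> X closure_of A"
    and loose: "\<And>S. \<lbrakk>S \<subseteq> A; countable S\<rbrakk> \<Longrightarrow> p \<notin> X closure_of S"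
  obtains a G where
    "\<And>i. closedin X (G i)" "\<And>i. a i \<in> topspace X"
    "\<And>i j. (i, j) \<in> omega1 \<Longrightarrow> a j \<in> G i"
    "\<And>i. G i \<inter> X closure_of (a ` underS omega1 i) = {}"
proof -
  have cX: "compact_space X" and reg: "regular_space X"
    using X compact_Hausdorff_imp_regular_space unfolding compactum_def by blast+
  \<comment> \<open>The requirement on the pair \<open>r = (a i, G i)\<close>, given the earlier pairs \<open>F j\<close>.\<close>
  define ok where "ok F i r \<longleftrightarrow>
      closedin X (snd r) \<and> p \<in> X interior_of snd r
      \<and> snd r \<inter> X closure_of ((fst \<circ> F) ` underS omega1 i) = {}
      \<and> fst r \<in> snd r \<and> (\<forall>j\<in>underS omega1 i. fst r \<in> snd (F j))
      \<and> (\<exists>S\<subseteq>A. countable S \<and> fst r \<in> X closure_of S)"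
    for F :: "nat set \<Rightarrow> 'a \<times> 'a set" and i and r :: "'a \<times> 'a set"
  have step: "\<exists>r. ok F i r" if IH: "\<And>j. (j, i) \<in> omega1 - Id \<Longrightarrow> ok F j (F j)" for F i
  proof -
    let ?I = "underS omega1 i"
    have IH: "ok F j (F j)" if "j \<in> ?I" for j
      using IH that by (auto simp: underS_def)
    then have "\<forall>j\<in>?I. \<exists>S\<subseteq>A. countable S \<and> fst (F j) \<in> X closure_of S"
      unfolding ok_def by blast
    then obtain S where S: "\<And>j. j \<in> ?I \<Longrightarrow> S j \<subseteq> A \<and> countable (S j) \<and> fst (F j) \<in> X closure_of S j"
      by metis
    define T where "T = (\<Union>j\<in>?I. S j)"
    have T: "T \<subseteq> A" "countable T"
      unfolding T_def using S countable_underS_omega1 by auto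
    have "X closure_of S j \<subseteq> X closure_of T" if "j \<in> ?I" for j
      unfolding T_def using that by (intro closure_of_mono) auto
    then have "(fst \<circ> F) ` ?I \<subseteq> X closure_of T" using S by auto
    then have FT: "X closure_of ((fst \<circ> F) ` ?I) \<subseteq> X closure_of T"
      by (intro closure_of_minimal) auto
    have "openin X (topspace X - X closure_of T)" by auto
    moreover have "p \<in> topspace X - X closure_of T"
      using loose[OF T] p by (auto simp: in_closure_of)
    ultimately obtain V H where H: "openin X V" "closedin X H" "p \<in> V" "V \<subseteq> H"
        "H \<subseteq> topspace X - X closure_of T"
      using reg unfolding neighbourhood_base_of_closedin[symmetric] neighbourhood_base_of by meson
    then have pH: "p \<in> X interior_of H" by (auto simp: interior_of_def)
    obtain S' where S': "S' \<subseteq> A" "countable S'"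
        "X closure_of S' \<inter> \<Inter>(insert H ((snd \<circ> F) ` ?I)) \<noteq> {}"
    proof (rule countable_closed_nbhds_meet_closure[OF cX A p])
      show "countable (insert H ((snd \<circ> F) ` ?I))" using countable_underS_omega1 by simp
      show "closedin X G \<and> p \<in> X interior_of G" if "G \<in> insert H ((snd \<circ> F) ` ?I)" for G
        using that H(2) pH IH unfolding ok_def by auto
    qed
    then obtain x where "x \<in> X closure_of S'" "x \<in> H" "\<forall>j\<in>?I. x \<in> snd (F j)" by auto
    then have "ok F i (x, H)"
      unfolding ok_def using H(2,5) pH FT S' by auto
    then show ?thesis by blast
  qed
  have "\<exists>F. \<forall>i. ok F i (F i)"
  proof (rule dependent_wf_choice[OF omega1_wf])
    fix F F' :: "nat set \<Rightarrow> 'a \<times> 'a set" and i r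
    assume "\<And>j. (j, i) \<in> omega1 - Id \<Longrightarrow> F j = F' j"
    then have "\<And>j. j \<in> underS omega1 i \<Longrightarrow> F j = F' j" by (auto simp: underS_def)
    then show "ok F i r = ok F' i r" unfolding ok_def by (simp cong: image_cong)
  qed (rule step)
  then obtain F where F: "\<And>i. ok F i (F i)" by blast
  show thesis
  proof (rule that[of "snd \<circ> F" "fst \<circ> F"])
    show "closedin X ((snd \<circ> F) i)" "(snd \<circ> F) i \<inter> X closure_of ((fst \<circ> F) ` underS omega1 i) = {}" for i
      using F[of i] unfolding ok_def by auto
    show "(fst \<circ> F) i \<in> topspace X" for i
      using F[of i] closedin_subset unfolding ok_def by fastforce
    show "(fst \<circ> F) j \<in> (snd \<circ> F) i" if "(i, j) \<in> omega1" for i j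
    proof (cases "i = j")
      case True
      then show ?thesis using F[of j] unfolding ok_def by auto
    next
      case False
      then have "i \<in> underS omega1 j" using that by (simp add: underS_def)
      then show ?thesis using F[of j] unfolding ok_def by auto
    qed
  qed
qed

text \<open>The closures of the tails form a chain, so by compactness they have a common point, which
  belongs to every \<open>G i\<close> and so avoids the closures of the initial segments.\<close>

lemma free_sequence_cluster_point:
  assumes X: "compact_space X" and aX: "\<And>i. a i \<in> topspace X"
    and G: "\<And>i. closedin X (G i)" "\<And>i j. (i, j) \<in> omega1 \<Longrightarrow> a j \<in> G i"
      "\<And>i. G i \<inter> X closure_of (a ` underS omega1 i) = {}"
  obtains z where "z \<in> X closure_of (a ` Field omega1)"
    "\<And>i. i \<in> Field omega1 \<Longrightarrow> z \<notin> X closure_of (a ` underS omega1 i)"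
proof -
  define K where "K i = X closure_of (a ` {j. (i, j) \<in> omega1})" for i
  have aT: "a ` T \<subseteq> topspace X" for T using aX by auto
  obtain i0 where i0: "i0 \<in> Field omega1" using Field_cardSuc_not_empty[OF natLeq_Card_order] by blast
  have "\<Inter>(K ` Field omega1) \<noteq> {}"
  proof (rule compact_space_chain_Inter[OF X])
    show "K ` Field omega1 \<noteq> {}" using i0 by auto
  next
    fix C assume "C \<in> K ` Field omega1"
    then obtain i where i: "i \<in> Field omega1" "C = K i" by blast
    have "a i \<in> a ` {j. (i, j) \<in> omega1}" using omega1_refl[OF i(1)] by auto
    then have "a i \<in> K i" unfolding K_def by (rule subsetD[OF closure_of_subset[OF aT]])
    then show "closedin X C \<and> C \<noteq> {}" using i(2) by (auto simp: K_def)
  next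
    fix C D assume "C \<in> K ` Field omega1" "D \<in> K ` Field omega1"
    then obtain i j where ij: "i \<in> Field omega1" "C = K i" "j \<in> Field omega1" "D = K j" by blast
    have "K j \<subseteq> K i" if "(i, j) \<in> omega1" for i j
      unfolding K_def using omega1_trans[OF that] by (intro closure_of_mono image_mono) blast
    moreover have "(i, j) \<in> omega1 \<or> (j, i) \<in> omega1"
      using omega1_total[OF ij(1,3)] by (auto simp: underS_def)
    ultimately show "C \<subseteq> D \<or> D \<subseteq> C" using ij(2,4) by blast
  qed
  then obtain z where z: "\<And>i. i \<in> Field omega1 \<Longrightarrow> z \<in> K i" by auto
  show thesis
  proof (rule that)
    have "K i0 \<subseteq> X closure_of (a ` Field omega1)"
      unfolding K_def by (intro closure_of_mono image_mono) (auto intro: FieldI2)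
    then show "z \<in> X closure_of (a ` Field omega1)" using z[OF i0] by blast
    fix i assume i: "i \<in> Field omega1"
    have "K i \<subseteq> G i" unfolding K_def by (rule closure_of_minimal[OF _ G(1)]) (auto intro: G(2))
    then show "z \<notin> X closure_of (a ` underS omega1 i)" using z[OF i] G(3) by blast
  qed
qed

lemma Field_Nbhd: "Field (Nbhd p X) = Nbhd_set p X"
  by (auto simp: Nbhd_def Field_def)

lemma level_directed_Nbhd_inter:
  assumes "level_directed k (Nbhd p X) \<rho>"
    and "\<U> \<subseteq> {U \<in> Nbhd_set p X. \<rho> U = n}" "|\<U>| \<le>o k"
  shows "\<exists>W\<in>Nbhd_set p X. \<forall>U\<in>\<U>. W \<subseteq> U"
proof -
  obtain W where "W \<in> Nbhd_set p X" "\<forall>U\<in>\<U>. (U, W) \<in> Nbhd p X"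
    using assms unfolding level_directed_def Field_Nbhd by blast
  then show ?thesis by (auto simp: Nbhd_def)
qed

text \<open>If there were such a \<open>z\<close>, the complements \<open>U i\<close> of the closures of the initial segments would
  be neighborhoods of \<open>z\<close>. Some level contains \<open>U i\<close> for uncountably many \<open>i\<close>, and these \<open>i\<close> are
  cofinal in \<open>\<omega>\<^sub>1\<close>; a common refinement \<open>W\<close> of these neighborhoods would miss every \<open>a i\<close>. In other
  words, \<open>\<omega>\<^sub>1\<close> would lie Tukey below the neighborhood filter of \<open>z\<close>.\<close>

lemma no_cluster_point_of_free_sequence:
  assumes aX: "\<And>i. a i \<in> topspace X"
    and z: "z \<in> X closure_of (a ` Field omega1)"
      "\<And>i. i \<in> Field omega1 \<Longrightarrow> z \<notin> X closure_of (a ` underS omega1 i)"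
    and \<rho>: "level_directed omega1 (Nbhd z X) \<rho>"
  shows False
proof -
  define U where "U i = topspace X - X closure_of (a ` underS omega1 i)" for i
  have zX: "z \<in> topspace X" using z(1) by (auto simp: in_closure_of)
  have UN: "U i \<in> Nbhd_set z X" if "i \<in> Field omega1" for i
  proof -
    have "openin X (U i)" unfolding U_def by auto
    then show ?thesis
      using z(2)[OF that] zX by (auto simp: Nbhd_set_def U_def interior_of_openin)
  qed
  obtain n where n: "uncountable {i \<in> Field omega1. \<rho> (U i) = n}"
  proof (rule ccontr)
    assume "\<not> thesis"
    then have "countable (\<Union>n. {i \<in> Field omega1. \<rho> (U i) = n})" using that by blast
    moreover have "(\<Union>n. {i \<in> Field omega1. \<rho> (U i) = n}) = Field omega1" by auto
    ultimately show False using uncountable_Field_omega1 by simp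
  qed
  define J where "J = {i \<in> Field omega1. \<rho> (U i) = n}"
  have "J \<subseteq> Field omega1" by (auto simp: J_def)
  then have "|J| \<le>o |Field omega1|" by (rule card_of_mono1)
  then have "|U ` J| \<le>o omega1"
    by (rule ordLeq_ordIso_trans[OF ordLeq_transitive[OF card_of_image]
          card_of_Field_ordIso[OF Card_order_omega1]])
  moreover have "U ` J \<subseteq> {V \<in> Nbhd_set z X. \<rho> V = n}" using UN by (auto simp: J_def)
  ultimately have "\<exists>W\<in>Nbhd_set z X. \<forall>V\<in>U ` J. W \<subseteq> V"
    by (intro level_directed_Nbhd_inter[OF \<rho>])
  then obtain W where W: "W \<in> Nbhd_set z X" "\<And>i. i \<in> J \<Longrightarrow> W \<subseteq> U i" by auto
  have "z \<in> X interior_of W" using W(1) by (simp add: Nbhd_set_def)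
  then obtain y where "y \<in> a ` Field omega1" "y \<in> W"
    by (rule closure_of_meets_interior_of[OF z(1)])
  then obtain i where i: "i \<in> Field omega1" "a i \<in> W" by blast
  obtain j where j: "j \<in> J" "i \<in> underS omega1 j"
    by (rule uncountable_omega1_cofinal[OF \<open>J \<subseteq> Field omega1\<close> n[folded J_def] i(1)])
  have "a i \<in> U j" by (rule subsetD[OF W(2)[OF j(1)] i(2)])
  moreover have "a i \<in> X closure_of (a ` underS omega1 j)"
    by (rule subsetD[OF closure_of_subset]) (use aX j(2) in auto)
  ultimately show False by (simp add: U_def)
qed

lemma countably_tight_if_level_directed:
  assumes X: "compactum X"
    and level: "\<And>z. z \<in> topspace X \<Longrightarrow> \<exists>\<rho>. level_directed omega1 (Nbhd z X) \<rho>"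
    and A: "A \<subseteq> topspace X" and p: "p \<in> X closure_of A"
  obtains S where "S \<subseteq> A" "countable S" "p \<in> X closure_of S"
proof (rule ccontr)
  assume "\<not> thesis"
  then have "\<And>S. \<lbrakk>S \<subseteq> A; countable S\<rbrakk> \<Longrightarrow> p \<notin> X closure_of S" using that by blast
  then obtain a G where aG: "\<And>i. closedin X (G i)" "\<And>i. a i \<in> topspace X"
      "\<And>i j. (i, j) \<in> omega1 \<Longrightarrow> a j \<in> G i"
      "\<And>i. G i \<inter> X closure_of (a ` underS omega1 i) = {}"
    by (rule not_countably_tight_imp_free_sequence[OF X A p]) blast+
  have "compact_space X" using X by (simp add: compactum_def)
  then obtain z where z: "z \<in> X closure_of (a ` Field omega1)"
      "\<And>i. i \<in> Field omega1 \<Longrightarrow> z \<notin> X closure_of (a ` underS omega1 i)"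
    using free_sequence_cluster_point[OF _ aG(2,1,3,4)] by blast
  then have "z \<in> topspace X" by (simp add: in_closure_of)
  then obtain \<rho> where "level_directed omega1 (Nbhd z X) \<rho>"
    using level by blast
  then show False
    using no_cluster_point_of_free_sequence[of a X z \<rho>] aG(2) z by simp
qed

section \<open>A countable neighborhood base\<close>

text \<open>The base consists of the intersections \<open>K n\<close> of the levels. Countable tightness is what
  replaces the possibly very many neighborhoods on a level by countably many.\<close>

lemma countable_base_if_level_directed_countably_tight:
  assumes p: "p \<in> topspace X"
    and \<rho>: "level_directed omega1 (Nbhd p X) \<rho>"
    and tight: "\<And>A. \<lbrakk>A \<subseteq> topspace X; p \<in> X closure_of A\<rbrakk>
      \<Longrightarrow> \<exists>S\<subseteq>A. countable S \<and> p \<in> X closure_of S"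
  obtains \<B> where "countable \<B>" "cofinal_subset \<B> (Nbhd p X)"
proof -
  \<comment> \<open>Intersecting with the space matters for empty levels.\<close>
  define K where "K n = topspace X \<inter> \<Inter>{U \<in> Nbhd_set p X. \<rho> U = n}" for n
  have K: "K n \<in> Nbhd_set p X" for n
  proof (rule ccontr)
    assume "K n \<notin> Nbhd_set p X"
    then have "p \<in> X closure_of (topspace X - K n)"
      using p by (auto simp: Nbhd_set_def K_def closure_of_complement)
    then obtain S where S: "S \<subseteq> topspace X - K n" "countable S" "p \<in> X closure_of S"
      using tight[of "topspace X - K n"] by blast
    then have "\<forall>s\<in>S. \<exists>U\<in>Nbhd_set p X. \<rho> U = n \<and> s \<notin> U" unfolding K_def by blast
    then obtain U where U: "\<And>s. s \<in> S \<Longrightarrow> U s \<in> Nbhd_set p X \<and> \<rho> (U s) = n \<and> s \<notin> U s"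
      by metis
    have "U ` S \<subseteq> {U \<in> Nbhd_set p X. \<rho> U = n}" using U by auto
    moreover have "|U ` S| \<le>o omega1"
      by (rule countable_imp_ordLeq_omega1) (use S(2) in simp)
    ultimately have "\<exists>W\<in>Nbhd_set p X. \<forall>V\<in>U ` S. W \<subseteq> V"
      by (intro level_directed_Nbhd_inter[OF \<rho>])
    then obtain W where W: "W \<in> Nbhd_set p X" "\<And>s. s \<in> S \<Longrightarrow> W \<subseteq> U s" by auto
    have "p \<in> X interior_of W" using W(1) by (simp add: Nbhd_set_def)
    then obtain s where "s \<in> S" "s \<in> W"
      by (rule closure_of_meets_interior_of[OF S(3)])
    then show False using W(2) U by blast
  qed
  have "\<exists>V\<in>range K. (U, V) \<in> Nbhd p X" if "U \<in> Nbhd_set p X" for U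
  proof -
    have "K (\<rho> U) \<subseteq> U" using that by (auto simp: K_def)
    then show ?thesis using that K by (auto simp: Nbhd_def)
  qed
  then have "cofinal_subset (range K) (Nbhd p X)"
    unfolding cofinal_subset_def Field_Nbhd using K by blast
  then show thesis using that[of "range K"] by simp
qed

theorem corollary3p5:
  fixes X :: "'a topology"
  assumes "compactum X" and "topspace X \<noteq> {}"
  shows "\<exists>p\<in>topspace X. \<not> cofinally_equivalent (Nbhd p X) (coordinatewise natLeq omega2)"
proof (rule ccontr)
  assume "\<not> ?thesis"
  then have eq: "cofinally_equivalent (Nbhd p X) (coordinatewise natLeq (cardSuc omega1))"
    if "p \<in> topspace X" for p
    using that unfolding omega2_def by blast
  have level: "\<exists>\<rho>. level_directed omega1 (Nbhd z X) \<rho>" if "z \<in> topspace X" for z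
    by (rule natLeq_times_cardSuc_level_directed[OF Card_order_omega1 infinite_Field_omega1
          eq[OF that]]) (rule exI)
  obtain p where p: "p \<in> topspace X" using assms(2) by blast
  then obtain \<rho> where \<rho>: "level_directed omega1 (Nbhd p X) \<rho>" using level by blast
  have "\<exists>S\<subseteq>A. countable S \<and> p \<in> X closure_of S"
    if "A \<subseteq> topspace X" "p \<in> X closure_of A" for A
    by (rule countably_tight_if_level_directed[OF assms(1) level that]) blast+
  then obtain \<B> where "countable \<B>" "cofinal_subset \<B> (Nbhd p X)"
    by (rule countable_base_if_level_directed_countably_tight[OF p \<rho>])
  then show False
    using natLeq_times_cardSuc_no_countable_cofinal[OF Card_order_omega1 infinite_Field_omega1
        eq[OF p]] by simp
qed

end
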